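(* Let $m\ge2$ and $\alpha>0$. (a) (BH; assume PRDS.) If $\mathbf R^{\mathrm{BH}}_\alpha\ne[m]$, then $\boldsymbol{\mathcal R}^{\overline{\mathrm{BH}}}_\alpha=\{\emptyset,\mathbf R^{\mathrm{BH}}_\alpha\}$. If $\mathbf R^{\mathrm{BH}}_\alpha=[m]$, then $\boldsymbol{\mathcal R}^{\overline{\mathrm{BH}}}_\alpha=2^{[m]}$. (b) (Minimally adaptive BH; assume PRDS.) Always $\boldsymbol{\mathcal R}^{\overline{\mathrm{MABH}}}_\alpha=\{\emptyset,\mathbf R^{\mathrm{MABH}}_\alpha\}$. (c) (Adaptive BH; assume that the p-values are independent, that the null-proportion estimator $\hat\pi$ is coordinatewise nondecreasing and that it satisfies $\mathbb E_{\mathrm P}(1/\hat{\boldsymbol\pi}_0^i)\le m/|N_{\mathrm P}|$ for all $\mathrm P\in M$, $i\in N_{\mathrm P}$.) Always $\boldsymbol{\mathcal R}^{\overline{\mathrm{adaBH}}}_\alpha=\{\emptyset,\mathbf R^{\mathrm{adaBH}}_\alpha\}$.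
   Context: Setting: $M$ is a set of probability measures on a measurable space; $[m]=\{1,\dots,m\}$; hypotheses $H_1,\dots,H_m\subseteq M$; $N_{\mathrm P}=\{i\in[m]:\mathrm P\in H_i\}$; $\mathbf p_i\in[0,1]$ is a p-value for $H_i$, i.e. $\mathrm P(\mathbf p_i\le t)\le t$ for $t\in[0,1]$, $\mathrm P\in H_i$. $\mathrm{FDP}_S(R)=|R\cap S|/(|R|\vee1)$. For a family $\mathbf E=(\mathbf e_S)_{S\in 2^{[m]}}$ of nonnegative random variables (with $\mathbf e_\emptyset=0$), $\mathcal R^{\mathrm{FDR}}_\alpha(\mathbf E)=\{R\in 2^{[m]}:\mathbf e_S\ge\mathrm{FDP}_S(R)/\alpha\ \forall S\in 2^{[m]}\}$. PRDS: for every increasing (upward closed) measurable $A\subseteq\mathbb R^m$, every $\mathrm P\in M$ and $i\in N_{\mathrm P}$, $\mathrm P((\mathbf p_1,\dots,\mathbf p_m)\in A\mid\mathbf p_i\le t)$ is weakly increasing in $t$. Let $\mathbf p_{(r)}$ be the $r$th smallest p-value and $\mathbf R^{(r)}$ the set of indices of the $r$ smallest p-values (ties broken by smallest index), $\mathbf R^{(0)}=\emptyset$. Maxima over empty sets are taken to be $0$. BH: $\mathbf R^{\mathrm{BH}}_\alpha=\mathbf R^{(\mathbf r)}$, $\mathbf r=\max\{r\in[m]:\mathbf p_{(r)}\le\alpha r/m\}$. $\boldsymbol{\mathcal R}^{\overline{\mathrm{BH}}}_\alpha=\mathcal R^{\mathrm{FDR}}_\alpha(\mathbf E)$ with, for nonempty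 $S$, $\mathbf e_S=\frac1{|S|}\sum_{i\in S}\frac{m}{\alpha|\mathbf R^{\mathrm{BH}}_\alpha|}\mathbf 1\{\mathbf p_i\le\alpha|\mathbf R^{\mathrm{BH}}_\alpha|/m\}$ (interpreted as $0$ if $\mathbf R^{\mathrm{BH}}_\alpha=\emptyset$). Minimally adaptive BH: $\mathbf R^{\mathrm{MABH}}_\alpha=\emptyset$ if $\mathbf R^{\mathrm{BH}}_\alpha=\emptyset$, and otherwise $\mathbf R^{\mathrm{MABH}}_\alpha=\mathbf R^{(\mathbf r')}$ with $\mathbf r'=\max\{r\in[m]:\mathbf p_{(r)}/r\le\alpha/(m-1)\}$. $\boldsymbol{\mathcal R}^{\overline{\mathrm{MABH}}}_\alpha=\mathcal R^{\mathrm{FDR}}_\alpha(\mathbf E)$ with $\mathbf e_{[m]}=\mathbf 1\{\mathbf R^{\mathrm{BH}}_\alpha\ne\emptyset\}/\alpha$ and, for nonempty $S\subsetneq[m]$, $\mathbf e_S=\frac{m-1}{|S|}\sum_{i\in S}\frac{1}{\alpha|\mathbf R^{\mathrm{MABH}}_\alpha|}\mathbf 1\{\mathbf p_i\le\alpha|\mathbf R^{\mathrm{MABH}}_\alpha|/(m-1)\}$ (interpreted as $0$ if $\mathbf R^{\mathrm{MABH}}_\alpha=\emptyset$). Adaptive BH: $\hat\pi:[0,1]^m\to(0,\infty)$ is a (measurable) estimator of the null proportion, $\hat{\boldsymbol\pi}_0^i=\hat\pi(\mathbf p_1,\dots,\mathbf p_{i-1},0,\mathbf p_{i+1},\dots,\mathbf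 p_m)$, $\hat{\boldsymbol\pi}_0=\max_{i\in[m]}\hat{\boldsymbol\pi}_0^i$. $\mathbf R^{\mathrm{adaBH}}_\alpha=\mathbf R^{(\mathbf r'')}$ with $\mathbf r''=\max(\{r\in[m]:\mathbf p_{(r)}/r\le\alpha/(\hat{\boldsymbol\pi}_0m)\}\cup\{0\})$. $\boldsymbol{\mathcal R}^{\overline{\mathrm{adaBH}}}_\alpha=\mathcal R^{\mathrm{FDR}}_\alpha(\mathbf E)$ with $\mathbf e_S=\sum_{i\in S}\frac{1}{\alpha(|\mathbf R^{\mathrm{adaBH}}_\alpha|\vee1)}\mathbf 1\{\mathbf p_i\le\alpha(|\mathbf R^{\mathrm{adaBH}}_\alpha|\vee1)/(m\hat{\boldsymbol\pi}_0)\}$. *)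

theory Defs
  imports "HOL-Probability.Probability"
begin

definition true_nulls :: "nat \<Rightarrow> (nat \<Rightarrow> 'w measure set) \<Rightarrow> 'w measure \<Rightarrow> nat set" where
  "true_nulls m H P = {i \<in> {1..m}. P \<in> H i}"

definition p_value_for :: "'w measure set \<Rightarrow> ('w \<Rightarrow> real) \<Rightarrow> bool" where
  "p_value_for H0 q \<longleftrightarrow> (\<forall>P\<in>H0. \<forall>t\<in>{0..1}. \<P>(w in P. q w \<le> t) \<le> t)"

definition increasing_set :: "nat \<Rightarrow> (nat \<Rightarrow> real) set \<Rightarrow> bool" where
  "increasing_set m A \<longleftrightarrow>
     (\<forall>x\<in>A. \<forall>y \<in> {1..m} \<rightarrow>\<^sub>E UNIV. (\<forall>i\<in>{1..m}. x i \<le> y i) \<longrightarrow> y \<in> A)"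

text \<open>
  The space of real \<open>m\<close>-vectors is the product space over the index set \<open>{1..m}\<close>, whose points
  are functions restricted to that set. The conditional probability is only considered for those
  \<open>t\<close> at which the conditioning event has positive probability.
\<close>
definition PRDS ::
  "nat \<Rightarrow> 'w measure set \<Rightarrow> (nat \<Rightarrow> 'w measure set) \<Rightarrow> (nat \<Rightarrow> 'w \<Rightarrow> real) \<Rightarrow> bool" where
  "PRDS m M H p \<longleftrightarrow>
     (\<forall>A \<in> sets (\<Pi>\<^sub>M i\<in>{1..m}. (borel :: real measure)). increasing_set m A \<longrightarrow>
       (\<forall>P\<in>M. \<forall>i \<in> true_nulls m H P.
         mono_on {t. \<P>(w in P. p i w \<le> t) > 0}
           (\<lambda>t. \<P>(w in P. (\<lambda>j\<in>{1..m}. p j w) \<in> A \<bar> p i w \<le> t))))"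

definition FDP :: "nat set \<Rightarrow> nat set \<Rightarrow> real" where
  "FDP S R = real (card (R \<inter> S)) / real (max (card R) 1)"

text \<open>
  The notions below are stated for one realisation: \<open>e\<close> is a realised family of
  \<open>e\<close>-values and \<open>x\<close> a realised vector of p-values, of which only the entries
  with index in \<open>{1..m}\<close> matter.
\<close>
definition FDR_collection :: "nat \<Rightarrow> real \<Rightarrow> (nat set \<Rightarrow> real) \<Rightarrow> nat set set" where
  "FDR_collection m \<alpha> e =
     {R \<in> Pow {1..m}. \<forall>S \<in> Pow {1..m}. e S \<ge> FDP S R / \<alpha>}"

text \<open>The \<open>r\<close>th smallest entry is meaningful for \<open>r\<close> in \<open>{1..m}\<close> only.\<close>
definition order_stat :: "nat \<Rightarrow> (nat \<Rightarrow> real) \<Rightarrow> nat \<Rightarrow> real" where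
  "order_stat m x r = sort (map x [1..<Suc m]) ! (r - 1)"

text \<open>Since \<^const>\<open>sort_key\<close> is stable, ties are broken in favour of the smallest index.\<close>
definition smallest_idx :: "nat \<Rightarrow> (nat \<Rightarrow> real) \<Rightarrow> nat \<Rightarrow> nat set" where
  "smallest_idx m x r = set (take r (sort_key x [1..<Suc m]))"

definition max0 :: "nat set \<Rightarrow> nat" where
  "max0 A = (if A = {} then 0 else Max A)"

definition BH_set :: "nat \<Rightarrow> real \<Rightarrow> (nat \<Rightarrow> real) \<Rightarrow> nat set" where
  "BH_set m \<alpha> x =
     smallest_idx m x (max0 {r \<in> {1..m}. order_stat m x r \<le> \<alpha> * real r / real m})"

definition BH_e :: "nat \<Rightarrow> real \<Rightarrow> (nat \<Rightarrow> real) \<Rightarrow> nat set \<Rightarrow> real" where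
  "BH_e m \<alpha> x S =
     (let k = real (card (BH_set m \<alpha> x)) in
      if S = {} \<or> BH_set m \<alpha> x = {} then 0
      else 1 / real (card S) *
        (\<Sum>i\<in>S. real m / (\<alpha> * k) * of_bool (x i \<le> \<alpha> * k / real m)))"

definition MABH_set :: "nat \<Rightarrow> real \<Rightarrow> (nat \<Rightarrow> real) \<Rightarrow> nat set" where
  "MABH_set m \<alpha> x =
     (if BH_set m \<alpha> x = {} then {}
      else smallest_idx m x
        (max0 {r \<in> {1..m}. order_stat m x r / real r \<le> \<alpha> / (real m - 1)}))"

definition MABH_e :: "nat \<Rightarrow> real \<Rightarrow> (nat \<Rightarrow> real) \<Rightarrow> nat set \<Rightarrow> real" where
  "MABH_e m \<alpha> x S =
     (let k = real (card (MABH_set m \<alpha> x)) in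
      if S = {} then 0
      else if S = {1..m} then of_bool (BH_set m \<alpha> x \<noteq> {}) / \<alpha>
      else if MABH_set m \<alpha> x = {} then 0
      else (real m - 1) / real (card S) *
        (\<Sum>i\<in>S. 1 / (\<alpha> * k) * of_bool (x i \<le> \<alpha> * k / (real m - 1))))"

abbreviation unit_cube :: "nat \<Rightarrow> (nat \<Rightarrow> real) set" where
  "unit_cube m \<equiv> {1..m} \<rightarrow>\<^sub>E {0..1}"

definition null_prop_estimator :: "nat \<Rightarrow> ((nat \<Rightarrow> real) \<Rightarrow> real) \<Rightarrow> bool" where
  "null_prop_estimator m pihat \<longleftrightarrow>
     pihat \<in> borel_measurable (\<Pi>\<^sub>M i\<in>{1..m}. restrict_space borel {0..1}) \<and>
     (\<forall>x \<in> unit_cube m. pihat x > 0)"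

definition pi0_at :: "nat \<Rightarrow> ((nat \<Rightarrow> real) \<Rightarrow> real) \<Rightarrow> (nat \<Rightarrow> real) \<Rightarrow> nat \<Rightarrow> real" where
  "pi0_at m pihat x i = pihat (\<lambda>j\<in>{1..m}. if j = i then 0 else x j)"

definition pi0 :: "nat \<Rightarrow> ((nat \<Rightarrow> real) \<Rightarrow> real) \<Rightarrow> (nat \<Rightarrow> real) \<Rightarrow> real" where
  "pi0 m pihat x = (MAX i\<in>{1..m}. pi0_at m pihat x i)"

definition adaBH_set ::
  "nat \<Rightarrow> real \<Rightarrow> ((nat \<Rightarrow> real) \<Rightarrow> real) \<Rightarrow> (nat \<Rightarrow> real) \<Rightarrow> nat set" where
  "adaBH_set m \<alpha> pihat x =
     smallest_idx m x
       (Max ({r \<in> {1..m}. order_stat m x r / real r \<le> \<alpha> / (pi0 m pihat x * real m)} \<union> {0}))"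

definition adaBH_e ::
  "nat \<Rightarrow> real \<Rightarrow> ((nat \<Rightarrow> real) \<Rightarrow> real) \<Rightarrow> (nat \<Rightarrow> real) \<Rightarrow> nat set \<Rightarrow> real" where
  "adaBH_e m \<alpha> pihat x S =
     (let k = real (max (card (adaBH_set m \<alpha> pihat x)) 1) in
      \<Sum>i\<in>S. 1 / (\<alpha> * k) * of_bool (x i \<le> \<alpha> * k / (real m * pi0 m pihat x)))"

end

(*
  The claims hold pointwise, for every realisation of the p-values. By maximality of the number k of
  rejections, each procedure rejects exactly the indices below its final threshold; call this set B.
  Hence e_S is proportional to |S \<inter> B|, up to normalisation by |S|. Singletons S = {i} with
  i \<notin> B force any member R of the collection to lie in B. If R is a nonempty proper subset of
  B, then S = R \<union> ([m] - B) (for BH with B \<noteq> [m] and for minimally adaptive BH) or S = R (for adaptive BH) violates the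
  constraint.
*)
theory Submission
  imports Defs
begin

section \<open>Step-up cutoffs and threshold sets\<close>

lemma order_stat_eq:
  "r \<in> {1..m} \<Longrightarrow> order_stat m x r = x (sort_key x [1..<Suc m] ! (r - 1))"
proof -
  assume r: "r \<in> {1..m}"
  have "sort (map x [1..<Suc m]) = map x (sort_key x [1..<Suc m])"
    by (rule properties_for_sort) simp_all
  moreover have "r - 1 < length (sort_key x [1..<Suc m])"
    using r by (auto simp del: upt_Suc)
  ultimately show ?thesis
    by (simp only: order_stat_def nth_map)
qed

lemma card_smallest_idx:
  assumes "k \<le> m" shows "card (smallest_idx m x k) = k"
proof -
  have "distinct (take k (sort_key x [1..<Suc m]))"
    by (simp del: upt_Suc)
  then show ?thesis
    using assms by (simp add: smallest_idx_def distinct_card del: upt_Suc)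
qed

lemma smallest_idx_subset: "smallest_idx m x k \<subseteq> {1..m}"
  unfolding smallest_idx_def
  by (rule order_trans[OF set_take_subset]) (auto simp del: upt_Suc)

lemma smallest_idx_eq_iff_empty:
  "k \<le> m \<Longrightarrow> smallest_idx m x k = {} \<longleftrightarrow> k = 0"
  by (metis card_smallest_idx card.empty smallest_idx_def take0 list.set(1))

lemma Max_Un_0: "finite A \<Longrightarrow> Max (A \<union> {0}) = max0 A"
  by (simp add: max0_def)

text \<open>Maximality is packaged here so that the empty case, where \<open>max0\<close> yields k =
  0, is settled once. The guard \<open>k > 0\<close> keeps \<open>order_stat\<close> within its
  meaningful range of ranks.\<close>

lemma order_stat_max:
  fixes c :: real and m :: nat and x :: "nat \<Rightarrow> real"
  defines "k \<equiv> max0 {r \<in> {1..m}. order_stat m x r \<le> c * real r}"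
  shows "k \<le> m"
    and "k > 0 \<Longrightarrow> order_stat m x k \<le> c * real k"
    and "\<And>r. r \<in> {1..m} \<Longrightarrow> order_stat m x r \<le> c * real r \<Longrightarrow> r \<le> k"
proof -
  let ?A = "{r \<in> {1..m}. order_stat m x r \<le> c * real r}"
  have fin: "finite ?A" by simp
  have mem: "k \<in> ?A" if "?A \<noteq> {}"
    using Max_in[OF fin that] that by (simp only: k_def max0_def if_False)
  show "k \<le> m"
    using mem by (cases "?A = {}") (auto simp: k_def max0_def)
  show "order_stat m x k \<le> c * real k" if "k > 0"
    using mem that by (cases "?A = {}") (auto simp: k_def max0_def)
  show "r \<le> k" if "r \<in> {1..m}" "order_stat m x r \<le> c * real r" for r
  proof -
    have "r \<in> ?A" using that by simp
    then show ?thesis using Max_ge[OF fin, of r] unfolding k_def max0_def by auto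
  qed
qed

text \<open>The \<open>max\<close> also covers the case of no rejections, where the threshold is \<open>c\<close>.\<close>
lemma step_up_threshold:
  fixes c :: real and m :: nat and x :: "nat \<Rightarrow> real"
  assumes "c \<ge> 0"
  defines "k \<equiv> max0 {r \<in> {1..m}. order_stat m x r \<le> c * real r}"
  shows "smallest_idx m x k = {i \<in> {1..m}. x i \<le> c * real (max k 1)}"
proof -
  let ?ys = "sort_key x [1..<Suc m]"
  note kmax = order_stat_max[where m = m and x = x and c = c, folded k_def]
  have len: "length ?ys = m" and sety: "set ?ys = {1..m}"
    by (auto simp del: upt_Suc)
  have sorted: "sorted (map x ?ys)" by (rule sorted_sort_key)
  have mono: "x (?ys ! i) \<le> x (?ys ! j)" if "i \<le> j" "j < m" for i j
    using sorted_nth_mono[OF sorted that(1)] that len by (simp del: upt_Suc)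
  \<comment> \<open>The heart of the lemma: along the sorted list, the positions within the
    threshold are exactly the first k. Hence ties at the cutoff cannot separate
    \<open>smallest_idx\<close> from the threshold set. Positions start at 0, so position j has rank
    j + 1.\<close>
  have below: "x (?ys ! j) \<le> c * real (max k 1) \<longleftrightarrow> j < k" if j: "j < m" for j
  proof
    assume "j < k"
    then have "x (?ys ! j) \<le> x (?ys ! (k - 1))"
      using kmax(1) by (intro mono) auto
    also have "\<dots> \<le> c * real k"
      using kmax(1,2) \<open>j < k\<close> order_stat_eq[of k m x] by (simp del: upt_Suc)
    finally show "x (?ys ! j) \<le> c * real (max k 1)"
      using \<open>j < k\<close> by (simp add: max_absorb1 Suc_le_eq del: upt_Suc)
  next
    assume le: "x (?ys ! j) \<le> c * real (max k 1)"
    show "j < k"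
    proof (rule ccontr)
      assume "\<not> j < k"
      \<comment> \<open>For j >= k the threshold is at most c(j + 1), so rank j + 1 would itself
        satisfy the step-up condition and exceed the maximal rank k. For k = 0 this is why no value
        lies at or below c.\<close>
      then have "max k 1 \<le> Suc j" by simp
      then have "c * real (max k 1) \<le> c * real (Suc j)"
        using assms(1) by (intro mult_left_mono) (auto simp del: of_nat_Suc)
      with le have "order_stat m x (Suc j) \<le> c * real (Suc j)"
        using j order_stat_eq[of "Suc j" m x] by (simp del: upt_Suc of_nat_Suc)
      with kmax(3)[of "Suc j"] j \<open>\<not> j < k\<close> show False by simp
    qed
  qed
  have "smallest_idx m x k = (!) ?ys ` {..<k}"
    using nth_image[of k ?ys] kmax(1) len by (simp only: smallest_idx_def atLeast0LessThan)
  also have "{..<k} = {j \<in> {..<m}. x (?ys ! j) \<le> c * real (max k 1)}"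
  proof (rule set_eqI)
    fix j
    show "j \<in> {..<k} \<longleftrightarrow> j \<in> {j \<in> {..<m}. x (?ys ! j) \<le> c * real (max k 1)}"
      using below[of j] kmax(1) by (cases "j < m") (simp_all del: upt_Suc)
  qed
  also have "(!) ?ys ` \<dots> = {i \<in> (!) ?ys ` {..<m}. x i \<le> c * real (max k 1)}"
    by blast
  also have "(!) ?ys ` {..<m} = {1..m}"
    using sety len by (simp only: set_conv_nth) blast
  finally show ?thesis .
qed

text \<open>Turns the sums in the e-values into intersection counts. The threshold set on the right
  ranges over all of [m], so that the threshold equations of the procedures, read backwards, fold it
  into the rejected set.\<close>

lemma sum_of_bool_threshold:
  fixes a t :: real and x :: "nat \<Rightarrow> real"
  assumes "S \<subseteq> {1..m}"
  shows "(\<Sum>i\<in>S. a * of_bool (x i \<le> t)) = a * real (card (S \<inter> {i \<in> {1..m}. x i \<le> t}))"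
proof -
  have "finite S" using assms finite_subset by blast
  moreover have "S \<inter> {i \<in> {1..m}. x i \<le> t} = {i \<in> S. x i \<le> t}" using assms by auto
  ultimately show ?thesis
    by (simp add: sum_distrib_left[symmetric] sum.inter_filter[symmetric] of_bool_def)
qed

section \<open>FDR collections of e-values that count intersections\<close>

lemma FDR_collectionI:
  "R \<subseteq> {1..m} \<Longrightarrow> (\<And>S. S \<subseteq> {1..m} \<Longrightarrow> FDP S R / \<alpha> \<le> e S)
    \<Longrightarrow> R \<in> FDR_collection m \<alpha> e"
  by (simp add: FDR_collection_def)

lemma FDR_collectionD:
  assumes "R \<in> FDR_collection m \<alpha> e"
  shows "R \<subseteq> {1..m}" and "\<And>S. S \<subseteq> {1..m} \<Longrightarrow> FDP S R / \<alpha> \<le> e S"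
  using assms by (auto simp: FDR_collection_def)

lemma FDP_nonneg: "FDP S R \<ge> 0"
  by (simp add: FDP_def)

lemma FDP_le_1: "finite R \<Longrightarrow> FDP S R \<le> 1"
  using card_mono[of R "R \<inter> S"] by (simp add: FDP_def)

lemma FDP_eq_1: "finite R \<Longrightarrow> R \<noteq> {} \<Longrightarrow> R \<subseteq> S \<Longrightarrow> FDP S R = 1"
  by (simp add: FDP_def Int_absorb2 max_absorb1 card_gt_0_iff Suc_le_eq)

lemma empty_in_FDR_collection:
  "(\<And>S. S \<subseteq> {1..m} \<Longrightarrow> e S \<ge> 0) \<Longrightarrow> {} \<in> FDR_collection m \<alpha> e"
  by (rule FDR_collectionI) (simp_all add: FDP_def)

text \<open>Any i in R makes the FDP of R at {i} positive, which a vanishing e-value at {i} does not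
  allow.\<close>

lemma FDR_collection_subset:
  assumes "R \<in> FDR_collection m \<alpha> e" "\<alpha> > 0"
    and "\<And>i. i \<in> {1..m} - B \<Longrightarrow> e {i} = 0"
  shows "R \<subseteq> B"
proof
  fix i assume i: "i \<in> R"
  show "i \<in> B"
  proof (rule ccontr)
    assume "i \<notin> B"
    with i FDR_collectionD(1)[OF assms(1)] have i_in: "i \<in> {1..m} - B" by blast
    then have "FDP {i} R / \<alpha> \<le> 0"
      using FDR_collectionD(2)[OF assms(1), of "{i}"] assms(3)[of i] by simp
    moreover have "FDP {i} R > 0" using i by (simp add: FDP_def)
    ultimately show False using assms(2) by (simp add: divide_le_0_iff)
  qed
qed

text \<open>Settles the case without BH rejections, where the e-values of BH and of minimally
  adaptive BH vanish identically.\<close>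

lemma FDR_collection_eq_empty:
  assumes "\<alpha> > 0" "\<And>S. e S = 0"
  shows "FDR_collection m \<alpha> e = {{}}"
proof -
  have "{} \<in> FDR_collection m \<alpha> e" by (simp add: assms empty_in_FDR_collection)
  moreover have "R = {}" if "R \<in> FDR_collection m \<alpha> e" for R
    using FDR_collection_subset[OF that, of "{}"] assms by simp
  ultimately show ?thesis by blast
qed

text \<open>
  Both BH variants at once: \<open>n = m\<close> for BH and \<open>n = m - 1\<close> for minimally adaptive BH.
\<close>
lemma FDR_collection_normalised_counts:
  fixes e :: "nat set \<Rightarrow> real"
  assumes "\<alpha> > 0" and B: "B \<subseteq> {1..m}" "B \<noteq> {}"
    and n: "1 \<le> n" "n \<le> m" "m - 1 \<le> n"
    and strict: "n < m \<or> B \<noteq> {1..m}"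
    and e_empty: "e {} = 0"
    and e_small: "\<And>S. S \<subseteq> {1..m} \<Longrightarrow> S \<noteq> {} \<Longrightarrow> card S \<le> n \<Longrightarrow>
      e S = real n / (\<alpha> * real (card B)) * real (card (S \<inter> B)) / real (card S)"
    and e_large: "\<And>S. S \<subseteq> {1..m} \<Longrightarrow> n < card S \<Longrightarrow> e S = 1 / \<alpha>"
  shows "FDR_collection m \<alpha> e = {{}, B}"
proof -
  let ?k = "card B"
  have finB: "finite B" using B(1) finite_subset by blast
  have kpos: "?k > 0" using finB B(2) by (simp add: card_gt_0_iff)
  have km: "?k \<le> m" using card_mono[OF _ B(1)] by simp
  have nonneg: "e S \<ge> 0" if "S \<subseteq> {1..m}" for S
  proof -
    consider "S = {}" | "S \<noteq> {}" "card S \<le> n" | "n < card S" by linarith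
    then show ?thesis
      by cases (use that assms(1) e_empty e_small e_large in auto)
  qed
  have "{} \<in> FDR_collection m \<alpha> e" using nonneg by (rule empty_in_FDR_collection)
  moreover have "B \<in> FDR_collection m \<alpha> e"
  proof (rule FDR_collectionI[OF B(1)])
    fix S assume S: "S \<subseteq> {1..m}"
    consider "S = {}" | "S \<noteq> {}" "card S \<le> n" | "n < card S" by linarith
    then show "FDP S B / \<alpha> \<le> e S"
    proof cases
      case 1
      then show ?thesis by (simp add: FDP_def e_empty)
    next
      case 2
      have "card S > 0" using S 2(1) finite_subset[of S "{1..m}"] by (simp add: card_gt_0_iff)
      \<comment> \<open>This factor is the slack at B: for such S, e_S is the required bound
        FDP_S(B) / \<alpha> multiplied by n / |S|.\<close>
      then have "1 \<le> real n / real (card S)" using 2(2) by simp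
      then have "FDP S B / \<alpha> * 1 \<le> FDP S B / \<alpha> * (real n / real (card S))"
        using assms(1) by (intro mult_left_mono) (auto simp: FDP_nonneg)
      also have "\<dots> = e S"
        using kpos by (simp add: e_small[OF S 2] FDP_def Int_commute max_absorb1 Suc_le_eq mult_ac)
      finally show ?thesis by simp
    next
      case 3
      then show ?thesis
        using e_large[OF S] FDP_le_1[OF finB, of S] assms(1) by (simp add: divide_right_mono)
    qed
  qed
  moreover have "R = B" if R: "R \<in> FDR_collection m \<alpha> e" "R \<noteq> {}" for R
  proof (rule ccontr)
    assume "R \<noteq> B"
    moreover have "R \<subseteq> B"
    proof (rule FDR_collection_subset[OF R(1) assms(1)])
      fix i assume "i \<in> {1..m} - B"
      then show "e {i} = 0" using e_small[of "{i}"] n(1) by simp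
    qed
    ultimately have RB: "R \<subset> B" by blast
    have finR: "finite R" using RB finB finite_subset by blast
    \<comment> \<open>Adding the complement of B to R leaves the intersection with B equal to R and
      the FDP equal to 1, but makes |S| as large as possible. This minimises the normalised
      e-value.\<close>
    let ?r = "card R" and ?S = "R \<union> ({1..m} - B)"
    have rk: "?r < ?k" by (rule psubset_card_mono[OF finB RB])
    have rpos: "?r > 0" using finR R(2) by (simp add: card_gt_0_iff)
    have S: "?S \<subseteq> {1..m}" "?S \<noteq> {}" using RB B(1) R(2) by auto
    have "card ?S = ?r + card ({1..m} - B)"
      using finR RB by (intro card_Un_disjoint) auto
    also have "card ({1..m} - B) = m - ?k" using B(1) finB by (simp add: card_Diff_subset)
    finally have cS: "card ?S = ?r + (m - ?k)" .
    with rpos have spos: "card ?S > 0" by simp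
    have "?S \<inter> B = R" using RB by blast
    \<comment> \<open>Here |S| = m - (k - r) <= m - 1 <= n because R is a proper subset of B, so the
      formula for small sets applies.\<close>
    moreover have "card ?S \<le> n" using cS rk km n(3) by linarith
    ultimately have "e ?S = real n / (\<alpha> * real ?k) * real ?r / real (card ?S)"
      using e_small[OF S] by simp
    moreover have "FDP ?S R = 1" using finR R(2) by (simp add: FDP_eq_1)
    ultimately have "1 / \<alpha> \<le> real n / (\<alpha> * real ?k) * real ?r / real (card ?S)"
      using FDR_collectionD(2)[OF R(1) S(1)] by simp
    then have "real ?k * real (card ?S) \<le> real n * real ?r"
      using assms(1) kpos spos by (simp add: field_simps)
    moreover have "real (card ?S) = real ?r + real m - real ?k" using cS km by simp
    ultimately have "real ?k * (real ?r + real m - real ?k) \<le> real n * real ?r" by metis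
    \<comment> \<open>The difference k(r + m - k) - nr is rewritten as a sum of two nonnegative
      terms. One of them is positive as soon as n < m or k < m, which is what \<open>strict\<close>
      provides; for n = k = m both vanish, as for BH rejecting everything.\<close>
    then have "(real ?k - real ?r) * (real m - real ?k) + real ?r * (real m - real n) \<le> 0"
      by (simp add: algebra_simps)
    moreover have "n < m \<or> ?k < m"
      using strict B(1) km card_subset_eq[OF _ B(1)] by fastforce
    then have "0 < (real ?k - real ?r) * (real m - real ?k) + real ?r * (real m - real n)"
    proof
      assume "n < m"
      then show ?thesis using rk rpos km by (intro add_nonneg_pos) auto
    next
      assume "?k < m"
      then show ?thesis using rk n(2) by (intro add_pos_nonneg) auto
    qed
    ultimately show False by linarith
  qed
  ultimately show ?thesis by blast
qed

text \<open>Without division by |S|, enlarging the test set beyond R brings no gain, and S = R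
  already forces |R| >= |B|. The \<open>max\<close> lets B = {} be treated together with the other
  cases.\<close>

lemma FDR_collection_counts:
  fixes e :: "nat set \<Rightarrow> real"
  assumes "\<alpha> > 0" and B: "B \<subseteq> {1..m}"
    and e: "\<And>S. S \<subseteq> {1..m} \<Longrightarrow>
      e S = real (card (S \<inter> B)) / (\<alpha> * real (max (card B) 1))"
  shows "FDR_collection m \<alpha> e = {{}, B}"
proof -
  have finB: "finite B" using B finite_subset by blast
  have "{} \<in> FDR_collection m \<alpha> e"
    using assms(1) by (intro empty_in_FDR_collection) (simp add: e)
  \<comment> \<open>For R = B every constraint holds with equality.\<close>
  moreover have "B \<in> FDR_collection m \<alpha> e"
    by (rule FDR_collectionI[OF B]) (simp add: e FDP_def Int_commute mult.commute)
  moreover have "R = B" if R: "R \<in> FDR_collection m \<alpha> e" "R \<noteq> {}" for R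
  proof -
    have sub: "R \<subseteq> B"
      by (rule FDR_collection_subset[OF R(1) assms(1)]) (simp add: e)
    then have finR: "finite R" using finB finite_subset by blast
    have "1 / \<alpha> \<le> e R"
      using FDR_collectionD[OF R(1)] finR R(2) by (metis FDP_eq_1 order_refl)
    also have "e R = real (card R) / (\<alpha> * real (max (card B) 1))"
      using FDR_collectionD(1)[OF R(1)] sub by (simp add: e Int_absorb2)
    finally have "real (max (card B) 1) \<le> real (card R)"
      using assms(1) by (simp add: field_simps)
    then have "card B \<le> card R" by linarith
    with finB sub show ?thesis by (rule card_seteq)
  qed
  ultimately show ?thesis by blast
qed

section \<open>Threshold form of the three rejected sets\<close>

lemma BH_set_threshold:
  assumes "m \<ge> 1" "\<alpha> > 0" "BH_set m \<alpha> x \<noteq> {}"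
  shows "BH_set m \<alpha> x = {i \<in> {1..m}. x i \<le> \<alpha> * real (card (BH_set m \<alpha> x)) / real m}"
proof -
  define k where "k = max0 {r \<in> {1..m}. order_stat m x r \<le> \<alpha> / real m * real r}"
  have B: "BH_set m \<alpha> x = smallest_idx m x k" by (simp add: BH_set_def k_def)
  have km: "k \<le> m" unfolding k_def by (rule order_stat_max)
  then have "k > 0" and card: "card (BH_set m \<alpha> x) = k"
    using assms(3) by (simp_all add: B card_smallest_idx smallest_idx_eq_iff_empty)
  then have "max k 1 = k" by simp
  moreover have "smallest_idx m x k = {i \<in> {1..m}. x i \<le> \<alpha> / real m * real (max k 1)}"
    unfolding k_def using assms by (intro step_up_threshold) simp
  ultimately show ?thesis unfolding card unfolding B by simp
qed

text \<open>Since \<alpha>/m <= \<alpha>/(m - 1), the BH rank b also meets the minimally adaptive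
  condition. Hence 0 < b <= k, which gives nonemptiness and reduces \<open>max k 1\<close> to k in
  the general threshold.\<close>

lemma MABH_set_threshold:
  assumes "m \<ge> 2" "\<alpha> > 0" "BH_set m \<alpha> x \<noteq> {}"
  shows "MABH_set m \<alpha> x \<noteq> {}"
    and "MABH_set m \<alpha> x =
      {i \<in> {1..m}. x i \<le> \<alpha> * real (card (MABH_set m \<alpha> x)) / (real m - 1)}"
proof -
  let ?c = "\<alpha> / (real m - 1)"
  define k where "k = max0 {r \<in> {1..m}. order_stat m x r \<le> ?c * real r}"
  define b where "b = max0 {r \<in> {1..m}. order_stat m x r \<le> \<alpha> / real m * real r}"
  have "{r \<in> {1..m}. order_stat m x r / real r \<le> ?c} =
      {r \<in> {1..m}. order_stat m x r \<le> ?c * real r}"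
    by (intro Collect_cong conj_cong refl) (simp add: pos_divide_le_eq)
  then have K: "MABH_set m \<alpha> x = smallest_idx m x k"
    using assms(3) by (simp add: MABH_set_def k_def)
  have B: "BH_set m \<alpha> x = smallest_idx m x b" by (simp add: BH_set_def b_def)
  note kmax = order_stat_max[where m = m and x = x and c = ?c, folded k_def]
  note bmax = order_stat_max[where m = m and x = x and c = "\<alpha> / real m", folded b_def]
  have bpos: "b > 0" using assms(3) bmax(1) by (simp add: B smallest_idx_eq_iff_empty)
  have "order_stat m x b \<le> \<alpha> / real m * real b" by (rule bmax(2)[OF bpos])
  also have "\<dots> \<le> ?c * real b"
    using assms by (intro mult_right_mono divide_left_mono) auto
  finally have "b \<le> k" using kmax(3) bpos bmax(1) by simp
  with bpos have kpos: "k > 0" by simp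
  with kmax(1) show "MABH_set m \<alpha> x \<noteq> {}" by (simp add: K smallest_idx_eq_iff_empty)
  have "smallest_idx m x k = {i \<in> {1..m}. x i \<le> ?c * real (max k 1)}"
    unfolding k_def using assms by (intro step_up_threshold) simp
  moreover have "card (MABH_set m \<alpha> x) = k" "max k 1 = k"
    using kpos kmax(1) by (simp_all add: K card_smallest_idx)
  ultimately show "MABH_set m \<alpha> x =
      {i \<in> {1..m}. x i \<le> \<alpha> * real (card (MABH_set m \<alpha> x)) / (real m - 1)}"
    using K by simp
qed

text \<open>The slope depends on the data through \<open>pi0\<close>, but for a fixed realisation it
  is a positive constant, so the general step-up result applies. The \<open>max\<close> in the
  threshold matches the one in \<open>adaBH_e\<close>.\<close>

lemma adaBH_set_threshold:
  assumes "m \<ge> 1" "\<alpha> > 0" "pi0 m pihat x > 0"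
  shows "adaBH_set m \<alpha> pihat x = {i \<in> {1..m}.
    x i \<le> \<alpha> * real (max (card (adaBH_set m \<alpha> pihat x)) 1) / (real m * pi0 m pihat x)}"
proof -
  let ?c = "\<alpha> / (pi0 m pihat x * real m)"
  let ?A = "{r \<in> {1..m}. order_stat m x r \<le> ?c * real r}"
  define k where "k = max0 ?A"
  have eq: "{r \<in> {1..m}. order_stat m x r / real r \<le> ?c} = ?A"
    by (intro Collect_cong conj_cong refl) (simp add: pos_divide_le_eq)
  have "Max (?A \<union> {0}) = k"
    unfolding k_def by (rule Max_Un_0) simp
  with eq have K: "adaBH_set m \<alpha> pihat x = smallest_idx m x k"
    by (simp add: adaBH_set_def)
  have "k \<le> m" unfolding k_def by (rule order_stat_max)
  then have "card (adaBH_set m \<alpha> pihat x) = k" by (simp add: K card_smallest_idx)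
  moreover have "smallest_idx m x k = {i \<in> {1..m}. x i \<le> ?c * real (max k 1)}"
    unfolding k_def using assms by (intro step_up_threshold) simp
  ultimately show ?thesis using K by (simp add: mult.commute)
qed

section \<open>The collections of the three procedures\<close>

lemma BH_e_eq:
  assumes "m \<ge> 1" "\<alpha> > 0" "BH_set m \<alpha> x \<noteq> {}" "S \<subseteq> {1..m}"
  shows "BH_e m \<alpha> x S = real m / (\<alpha> * real (card (BH_set m \<alpha> x)))
    * real (card (S \<inter> BH_set m \<alpha> x)) / real (card S)"
  unfolding BH_e_def Let_def sum_of_bool_threshold[OF assms(4)]
    BH_set_threshold[OF assms(1-3), symmetric]
  using assms(3) by simp

lemma FDR_collection_BH:
  assumes "m \<ge> 1" "\<alpha> > 0" "BH_set m \<alpha> x \<noteq> {1..m}"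
  shows "FDR_collection m \<alpha> (BH_e m \<alpha> x) = {{}, BH_set m \<alpha> x}"
proof (cases "BH_set m \<alpha> x = {}")
  case True
  then show ?thesis
    using FDR_collection_eq_empty[OF assms(2), of "BH_e m \<alpha> x"] by (simp add: BH_e_def)
next
  case False
  show ?thesis
  proof (rule FDR_collection_normalised_counts[where n = m])
    show "BH_set m \<alpha> x \<subseteq> {1..m}" unfolding BH_set_def by (rule smallest_idx_subset)
    \<comment> \<open>Vacuous, as no subset of [m] has more than m elements.\<close>
    show "BH_e m \<alpha> x S = 1 / \<alpha>" if "S \<subseteq> {1..m}" "m < card S" for S
      using that card_mono[of "{1..m}" S] by simp
  qed (use assms False in \<open>auto simp: BH_e_eq BH_e_def[of _ _ _ "{}"]\<close>)
qed

text \<open>With B = [m] the count |S| cancels the normalisation, so e_S = 1/\<alpha> for every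
  nonempty S, and FDP never exceeds 1.\<close>

lemma FDR_collection_BH_full:
  assumes "m \<ge> 1" "\<alpha> > 0" "BH_set m \<alpha> x = {1..m}"
  shows "FDR_collection m \<alpha> (BH_e m \<alpha> x) = Pow {1..m}"
proof -
  have "R \<in> FDR_collection m \<alpha> (BH_e m \<alpha> x)" if R: "R \<subseteq> {1..m}" for R
  proof (rule FDR_collectionI[OF R])
    fix S :: "nat set" assume S: "S \<subseteq> {1..m}"
    have fin: "finite R" "finite S" using R S finite_subset by blast+
    show "FDP S R / \<alpha> \<le> BH_e m \<alpha> x S"
    proof (cases "S = {}")
      case True
      then show ?thesis by (simp add: FDP_def BH_e_def)
    next
      case False
      then have "BH_e m \<alpha> x S = 1 / \<alpha>"
        using BH_e_eq[OF assms(1,2) _ S] assms S fin by (simp add: Int_absorb2)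
      then show ?thesis using FDP_le_1[OF fin(1), of S] assms(2) by (simp add: divide_right_mono)
    qed
  qed
  then show ?thesis using FDR_collectionD(1) by blast
qed

text \<open>With n = m - 1 the only large set is [m] itself, whose separately defined e-value is
  1/\<alpha> once BH rejects something. This leaves n < m, so rejecting all of [m] needs no
  exception.\<close>

lemma FDR_collection_MABH:
  assumes "m \<ge> 2" "\<alpha> > 0"
  shows "FDR_collection m \<alpha> (MABH_e m \<alpha> x) = {{}, MABH_set m \<alpha> x}"
proof (cases "BH_set m \<alpha> x = {}")
  case True
  then show ?thesis
    using FDR_collection_eq_empty[OF assms(2), of "MABH_e m \<alpha> x"]
    by (simp add: MABH_e_def MABH_set_def)
next
  case False
  note thr = MABH_set_threshold[OF assms False]
  show ?thesis
  proof (rule FDR_collection_normalised_counts[where n = "m - 1"])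
    show "MABH_set m \<alpha> x \<subseteq> {1..m}" using False unfolding MABH_set_def if_not_P[OF False] by (intro smallest_idx_subset)
    show "MABH_e m \<alpha> x {} = 0" by (simp add: MABH_e_def)
  next
    fix S :: "nat set"
    assume S: "S \<subseteq> {1..m}" "S \<noteq> {}" "card S \<le> m - 1"
    then have "S \<noteq> {1..m}" using assms(1) by auto
    then show "MABH_e m \<alpha> x S = real (m - 1) / (\<alpha> * real (card (MABH_set m \<alpha> x)))
        * real (card (S \<inter> MABH_set m \<alpha> x)) / real (card S)"
      unfolding MABH_e_def Let_def sum_of_bool_threshold[OF S(1)] thr(2)[symmetric]
      using S(2) thr(1) assms(1) by (simp add: of_nat_diff)
  next
    fix S :: "nat set"
    assume S: "S \<subseteq> {1..m}" "m - 1 < card S"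
    then have "S = {1..m}" by (intro card_seteq) auto
    then show "MABH_e m \<alpha> x S = 1 / \<alpha>" using assms(1) False by (simp add: MABH_e_def)
  qed (use assms thr(1) in auto)
qed

lemma FDR_collection_adaBH:
  assumes "m \<ge> 1" "\<alpha> > 0" "pi0 m pihat x > 0"
  shows "FDR_collection m \<alpha> (adaBH_e m \<alpha> pihat x) = {{}, adaBH_set m \<alpha> pihat x}"
proof (rule FDR_collection_counts[OF assms(2)])
  show "adaBH_set m \<alpha> pihat x \<subseteq> {1..m}" unfolding adaBH_set_def by (rule smallest_idx_subset)
  fix S :: "nat set" assume "S \<subseteq> {1..m}"
  from sum_of_bool_threshold[OF this]
  show "adaBH_e m \<alpha> pihat x S = real (card (S \<inter> adaBH_set m \<alpha> pihat x))
      / (\<alpha> * real (max (card (adaBH_set m \<alpha> pihat x)) 1))"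
    by (simp only: adaBH_e_def Let_def adaBH_set_threshold[OF assms, symmetric]) simp
qed

text \<open>Setting one coordinate to 0 keeps the vector in the unit cube, where the estimator is
  positive. The maximum over the nonempty index set is then positive too.\<close>

lemma pi0_pos:
  assumes "m \<ge> 1" "null_prop_estimator m pihat" "\<And>i. i \<in> {1..m} \<Longrightarrow> x i \<in> {0..1}"
  shows "pi0 m pihat x > 0"
proof -
  have "pi0_at m pihat x i > 0" for i
  proof -
    have "(\<lambda>j\<in>{1..m}. if j = i then 0 else x j) \<in> unit_cube m"
      using assms(3) by auto
    then show ?thesis using assms(2) unfolding null_prop_estimator_def pi0_at_def by blast
  qed
  then show ?thesis using assms(1) by (simp add: pi0_def Max_gr_iff) (use assms(1) in auto)
qed

theorem theorem37:
  fixes Om :: "'w measure" and M :: "'w measure set" and H :: "nat \<Rightarrow> 'w measure set"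
    and p :: "nat \<Rightarrow> 'w \<Rightarrow> real" and m :: nat and \<alpha> :: real
    and pihat :: "(nat \<Rightarrow> real) \<Rightarrow> real"
  assumes "m \<ge> 2" and "\<alpha> > 0"
    and "M \<subseteq> space (prob_algebra Om)"
    and "\<And>i. i \<in> {1..m} \<Longrightarrow> H i \<subseteq> M"
    and "\<And>i. i \<in> {1..m} \<Longrightarrow> p i \<in> borel_measurable Om"
    and "\<And>i w. i \<in> {1..m} \<Longrightarrow> w \<in> space Om \<Longrightarrow> p i w \<in> {0..1}"
    and "\<And>i. i \<in> {1..m} \<Longrightarrow> p_value_for (H i) (p i)"
  shows
    "(PRDS m M H p \<longrightarrow>
        (\<forall>w \<in> space Om. let x = (\<lambda>i. p i w) in
          (BH_set m \<alpha> x \<noteq> {1..m} \<longrightarrow>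
             FDR_collection m \<alpha> (BH_e m \<alpha> x) = {{}, BH_set m \<alpha> x}) \<and>
          (BH_set m \<alpha> x = {1..m} \<longrightarrow>
             FDR_collection m \<alpha> (BH_e m \<alpha> x) = Pow {1..m}))) \<and>
     (PRDS m M H p \<longrightarrow>
        (\<forall>w \<in> space Om. let x = (\<lambda>i. p i w) in
          FDR_collection m \<alpha> (MABH_e m \<alpha> x) = {{}, MABH_set m \<alpha> x})) \<and>
     ((\<forall>P\<in>M. prob_space.indep_vars P (\<lambda>_. borel) p {1..m}) \<and>
      null_prop_estimator m pihat \<and>
      mono_on (unit_cube m) pihat \<and>
      (\<forall>P\<in>M. \<forall>i \<in> true_nulls m H P.
         (\<integral>\<^sup>+ w. ennreal (1 / pi0_at m pihat (\<lambda>j. p j w) i) \<partial>P)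
           \<le> ennreal (real m / real (card (true_nulls m H P)))) \<longrightarrow>
        (\<forall>w \<in> space Om. let x = (\<lambda>i. p i w) in
          FDR_collection m \<alpha> (adaBH_e m \<alpha> pihat x) = {{}, adaBH_set m \<alpha> pihat x}))"
proof -
  have m1: "m \<ge> 1" using assms(1) by simp
  \<comment> \<open>Everything is applied to one realisation w; the range of the p-values places it
    in the domain of the estimator.\<close>
  have pos: "pi0 m pihat (\<lambda>i. p i w) > 0"
    if "null_prop_estimator m pihat" "w \<in> space Om" for w
    using pi0_pos[OF m1 that(1)] assms(6)[OF _ that(2)] .
  show ?thesis
    unfolding Let_def
    by (intro conjI impI ballI FDR_collection_BH[OF m1 assms(2)]
        FDR_collection_BH_full[OF m1 assms(2)] FDR_collection_MABH[OF assms(1,2)]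
        FDR_collection_adaBH[OF m1 assms(2)] pos; (elim conjE)?; assumption)
qed

end
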